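(* Suppose $a$ is any composite odd integer, say $a=jk$, where $j>1$ and $k>1$ are integers. Let $n=(a^2+1)/2$. Then there are nonequivalent $(a,a)$-near-factorizations of $D_n$, i.e., there exist two $(a,a)$-near-factorizations of the dihedral group $D_n$ that are not equivalent.
   Context: For $n>2$, $D_n$ is the dihedral group of order $2n$. A $(k,\ell)$-near-factorization of a finite multiplicative group $G$ with identity $e$ is a pair $(A,B)$ of subsets with $|A|=k$, $|B|=\ell$, $|A|\cdot|B|=|G|-1$ and $AB=\{gh: g\in A,h\in B\}=G\setminus\{e\}$. Two near-factorizations $(A,B)$ and $(A',B')$ of $G$ are equivalent if $(A',B')=(f(A)h,\,h^{-1}f(B))$ for some $f\in\mathrm{Aut}(G)$ and $h\in G$. *)

theory Defs
  imports "HOL-Algebra.Algebra"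
begin

text \<open>
  The dihedral group of order \<open>2n\<close>: the pair \<open>(i, s)\<close> stands for the element \<open>r^i t^s\<close>,
  where the rotation \<open>r\<close> has order \<open>n\<close>, the reflection \<open>t\<close> has order 2 and \<open>t r t = r^(-1)\<close>;
  \<open>s = True\<close> thus marks the reflections.  For \<open>n = 0\<close> the carrier is empty, and \<open>n > 2\<close> is
  the range in which one speaks of the dihedral group.
\<close>

definition dihedral_group :: "nat \<Rightarrow> (int \<times> bool) monoid" where
  "dihedral_group n =
     \<lparr>carrier = {0..<int n} \<times> UNIV,
      monoid.mult = (\<lambda>(i, s) (j, s'). ((if s then i - j else i + j) mod int n, s \<noteq> s')),
      one = (0, False)\<rparr>"

lemma group_dihedral_group:
  assumes "n > 0"
  shows "group (dihedral_group n)"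
proof (rule groupI)
  fix x assume x: "x \<in> carrier (dihedral_group n)"
  obtain i s where xe: "x = (i, s)" by (cases x)
  let ?y = "((if s then i else - i) mod int n, s)"
  have "?y \<in> carrier (dihedral_group n)"
    using assms by (auto simp: dihedral_group_def)
  moreover have "?y \<otimes>\<^bsub>dihedral_group n\<^esub> x = \<one>\<^bsub>dihedral_group n\<^esub>"
    by (auto simp: dihedral_group_def xe mod_simps)
  ultimately show "\<exists>y\<in>carrier (dihedral_group n). y \<otimes>\<^bsub>dihedral_group n\<^esub> x = \<one>\<^bsub>dihedral_group n\<^esub>"
    by blast
qed (use assms in \<open>auto simp: dihedral_group_def mod_simps algebra_simps split: if_splits\<close>)

lemma finite_dihedral_group: "finite (carrier (dihedral_group n))"
  by (simp add: dihedral_group_def)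

lemma order_dihedral_group: "order (dihedral_group n) = 2 * n"
  by (simp add: dihedral_group_def order_def)

definition near_factorization ::
  "('a, 'b) monoid_scheme \<Rightarrow> nat \<Rightarrow> nat \<Rightarrow> 'a set \<Rightarrow> 'a set \<Rightarrow> bool" where
  "near_factorization G k l A B \<longleftrightarrow>
     group G \<and> finite (carrier G) \<and>
     A \<subseteq> carrier G \<and> B \<subseteq> carrier G \<and>
     card A = k \<and> card B = l \<and> card A * card B = order G - 1 \<and>
     A <#>\<^bsub>G\<^esub> B = carrier G - {\<one>\<^bsub>G\<^esub>}"

definition equivalent_near_factorizations ::
  "('a, 'b) monoid_scheme \<Rightarrow> 'a set \<times> 'a set \<Rightarrow> 'a set \<times> 'a set \<Rightarrow> bool" where
  "equivalent_near_factorizations G P P' \<longleftrightarrow>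
     (\<exists>f \<in> auto G. \<exists>h \<in> carrier G.
        P' = (f ` fst P #>\<^bsub>G\<^esub> h, inv\<^bsub>G\<^esub> h <#\<^bsub>G\<^esub> f ` snd P))"

end

theory Submission
  imports Defs
begin

text \<open>
  Write \<open>\<phi>(2i + s) = r\<^sup>i t\<^sup>s\<close>. This is a bijection from the integers modulo \<open>2n = a\<^sup>2 + 1\<close> to
  \<open>D\<^sub>n\<close> with \<open>\<phi>(x) \<phi>(y) = \<phi>(x \<plusminus> y)\<close>, the sign depending on the parity of \<open>x\<close> only; hence
  \<open>\<phi>(A) \<phi>(B) = \<phi>(A + B)\<close> whenever \<open>B = -B\<close>, and symmetric near-factorizations of the cyclic
  group become near-factorizations of the dihedral group.

  For odd \<open>m\<close> let \<open>I\<^sub>m\<close> be the symmetric integer interval with \<open>m\<close> elements. Expansion in balanced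
  digits of mixed radix \<open>j, k, k, j\<close> gives \<open>(I\<^sub>j + jk I\<^sub>k) + (j I\<^sub>k + jk\<^sup>2 I\<^sub>j) = I\<close>, the symmetric
  interval with \<open>a\<^sup>2\<close> elements, and translating the second summand by \<open>n\<close> moves the one missing residue
  from \<open>n\<close> to \<open>0\<close>. The pairs \<open>(j, k)\<close> and \<open>(a, 1)\<close> yield nonequivalent near-factorizations: the
  cardinality of \<open>A A\<^sup>-\<^sup>1\<close> is invariant under equivalence, and it equals \<open>(2j - 1)(2k - 1)\<close> for the
  former but is at most \<open>2a - 1\<close> for the latter.
\<close>

section \<open>Integer coordinates on the dihedral group\<close>

text \<open>The map \<open>\<phi>\<close> of the overview. Defining it on all integers instead of
  residues lets sums of integer sets be computed first and reduced modulo \<open>2n\<close> only at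
  the end.\<close>

definition dihedral_of_int :: "nat \<Rightarrow> int \<Rightarrow> int \<times> bool" where
  "dihedral_of_int n x = (x div 2 mod int n, odd x)"

text \<open>An odd \<open>x\<close> is a reflection, and moving it past the rotation part of
  \<open>y\<close> inverts that rotation. In either case the last bit and the halves combine without
  a carry: an even \<open>x\<close>, or subtraction from an odd \<open>x\<close>, leaves nothing to
  carry or borrow.\<close>

lemma dihedral_of_int_mult:
  "dihedral_of_int n x \<otimes>\<^bsub>dihedral_group n\<^esub> dihedral_of_int n y
     = dihedral_of_int n (if odd x then x - y else x + y)"
proof -
  have minus: "(x - y) div 2 = x div 2 - y div 2" if odd: "odd x"
  proof -
    obtain b where b: "x = 2 * b + 1" using odd by (rule oddE)
    show ?thesis
    proof (cases "even y")
      case True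
      then obtain c where c: "y = 2 * c" by (rule evenE)
      have "x - y = 1 + (b - c) * 2" using b c by simp
      then show ?thesis using b c by simp
    next
      case False
      then obtain c where c: "y = 2 * c + 1" by (rule oddE)
      have "x - y = (b - c) * 2" using b c by simp
      then show ?thesis using b c by simp
    qed
  qed
  have plus: "(x + y) div 2 = x div 2 + y div 2" if "even x"
    using that by (rule div_plus_div_distrib_dvd_left)
  show ?thesis
    by (cases "odd x")
      (simp_all add: dihedral_group_def dihedral_of_int_def minus plus mod_diff_eq mod_add_eq)
qed

lemma dihedral_of_int_eq_iff:
  "dihedral_of_int n x = dihedral_of_int n y \<longleftrightarrow> 2 * int n dvd x - y"
proof (cases "even x = even y")
  case True
  then have "x - y = 2 * (x div 2 - y div 2)"
    by (cases "even x") (auto elim!: evenE oddE)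
  then have "2 * int n dvd x - y \<longleftrightarrow> int n dvd x div 2 - y div 2"
    by (metis dvd_mult_cancel_left zero_neq_numeral)
  with True show ?thesis
    by (simp add: dihedral_of_int_def mod_eq_dvd_iff)
next
  case False
  then have "odd (x - y)" by simp
  then have "\<not> 2 * int n dvd x - y"
    using dvd_mult_left by blast
  with False show ?thesis
    by (auto simp: dihedral_of_int_def)
qed

lemma one_dihedral_group: "\<one>\<^bsub>dihedral_group n\<^esub> = dihedral_of_int n 0"
  by (simp add: dihedral_group_def dihedral_of_int_def)

lemma dihedral_of_int_closed:
  "n > 0 \<Longrightarrow> dihedral_of_int n x \<in> carrier (dihedral_group n)"
  by (simp add: dihedral_group_def dihedral_of_int_def)

lemma carrier_dihedral_group_image:
  assumes "n > 0"
  shows "carrier (dihedral_group n) = dihedral_of_int n ` {0..<2 * int n}"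
proof
  show "dihedral_of_int n ` {0..<2 * int n} \<subseteq> carrier (dihedral_group n)"
    using assms dihedral_of_int_closed by blast
  show "carrier (dihedral_group n) \<subseteq> dihedral_of_int n ` {0..<2 * int n}"
  proof
    fix z assume "z \<in> carrier (dihedral_group n)"
    then obtain i s where z: "z = (i, s)" "0 \<le> i" "i < int n"
      by (auto simp: dihedral_group_def)
    then have "z = dihedral_of_int n (2 * i + of_bool s)"
      by (cases s) (auto simp: dihedral_of_int_def)
    moreover have "2 * i + of_bool s \<in> {0..<2 * int n}"
      using z by (cases s) auto
    ultimately show "z \<in> dihedral_of_int n ` {0..<2 * int n}"
      by (rule image_eqI)
  qed
qed

lemma set_multI: "x \<in> A \<Longrightarrow> y \<in> B \<Longrightarrow> x \<otimes>\<^bsub>G\<^esub> y \<in> A <#>\<^bsub>G\<^esub> B"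
  unfolding set_mult_def by (rule UN_I, assumption, rule UN_I, assumption, rule singletonI)

text \<open>The sign in the multiplication rule is absorbed by passing from \<open>y\<close> to its
  negative inside \<open>B\<close>. Symmetry is required only modulo \<open>2n\<close>, since it
  will be applied to a translated set.\<close>

lemma set_mult_dihedral_of_int:
  assumes "\<And>y. y \<in> B \<Longrightarrow> \<exists>y'\<in>B. 2 * int n dvd y + y'"
  shows "dihedral_of_int n ` A <#>\<^bsub>dihedral_group n\<^esub> dihedral_of_int n ` B
           = dihedral_of_int n ` (\<lambda>(x, y). x + y) ` (A \<times> B)"
proof (intro equalityI subsetI)
  have flip: "\<exists>y'\<in>B. dihedral_of_int n (x + y) = dihedral_of_int n (x - y')"
    "\<exists>y'\<in>B. dihedral_of_int n (x - y) = dihedral_of_int n (x + y')" if "y \<in> B" for x y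
    using assms [OF that] by (auto simp: dihedral_of_int_eq_iff dvd_diff_commute algebra_simps
        dest: dvd_minus_iff [THEN iffD2])
  { fix z assume "z \<in> dihedral_of_int n ` A <#>\<^bsub>dihedral_group n\<^esub> dihedral_of_int n ` B"
    then obtain x y where "x \<in> A" "y \<in> B"
      "z = dihedral_of_int n (if odd x then x - y else x + y)"
      by (auto simp: set_mult_def dihedral_of_int_mult)
    then show "z \<in> dihedral_of_int n ` (\<lambda>(x, y). x + y) ` (A \<times> B)"
      using flip(2) [of y x] by (auto simp: image_iff split: if_splits) }
  { fix z assume "z \<in> dihedral_of_int n ` (\<lambda>(x, y). x + y) ` (A \<times> B)"
    then obtain x y where xy: "x \<in> A" "y \<in> B" "z = dihedral_of_int n (x + y)"
      by auto
    obtain y' where "y' \<in> B" and z: "z = dihedral_of_int n x \<otimes>\<^bsub>dihedral_group n\<^esub> dihedral_of_int n y'"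
    proof (cases "odd x")
      case True
      then show thesis using flip(1) [OF xy(2), of x] xy that by (auto simp: dihedral_of_int_mult)
    next
      case False
      then show thesis using xy that [of y] by (simp add: dihedral_of_int_mult)
    qed
    then show "z \<in> dihedral_of_int n ` A <#>\<^bsub>dihedral_group n\<^esub> dihedral_of_int n ` B"
      unfolding z by (intro set_multI imageI xy(1)) }
qed

text \<open>Odd arguments are reflections, hence involutions; even ones are rotations, inverted by
  negation. Both operations preserve a symmetric set.\<close>

lemma set_inv_dihedral_of_int:
  assumes "n > 0" and "\<And>x. x \<in> A \<Longrightarrow> - x \<in> A"
  shows "set_inv\<^bsub>dihedral_group n\<^esub> (dihedral_of_int n ` A) = dihedral_of_int n ` A"
proof -
  interpret group "dihedral_group n" by (rule group_dihedral_group [OF \<open>n > 0\<close>])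
  have inv: "inv\<^bsub>dihedral_group n\<^esub> (dihedral_of_int n x) = dihedral_of_int n (if odd x then x else - x)"
    for x by (rule inv_equality)
      (auto simp: dihedral_of_int_mult one_dihedral_group dihedral_of_int_closed \<open>n > 0\<close>)
  have mem: "(if odd x then x else - x) \<in> A" if "x \<in> A" for x
    using assms(2) [OF that] that by simp
  have "set_inv\<^bsub>dihedral_group n\<^esub> (dihedral_of_int n ` A)
      = dihedral_of_int n ` (\<lambda>x. if odd x then x else - x) ` A"
    by (simp only: SET_INV_def inv image_image UNION_singleton_eq_range)
  also have "(\<lambda>x. if odd x then x else - x) ` A = A"
  proof (intro equalityI subsetI)
    show "x \<in> A" if "x \<in> (\<lambda>x. if odd x then x else - x) ` A" for x
      using that mem by blast
    show "x \<in> (\<lambda>x. if odd x then x else - x) ` A" if "x \<in> A" for x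
      using mem [OF that] by (rule rev_image_eqI) simp
  qed
  finally show ?thesis .
qed

lemma card_set_mult_le:
  assumes "finite A" "finite B"
  shows "card (A <#>\<^bsub>G\<^esub> B) \<le> card A * card B"
proof -
  have "A <#>\<^bsub>G\<^esub> B = (\<lambda>z. fst z \<otimes>\<^bsub>G\<^esub> snd z) ` (A \<times> B)"
    by (auto simp: set_mult_def image_iff; metis)
  then show ?thesis
    using card_image_le [of "A \<times> B" "\<lambda>z. fst z \<otimes>\<^bsub>G\<^esub> snd z"] assms
    by (simp add: card_cartesian_product)
qed

text \<open>Passes from integers to the group. Upper bounds on the cardinalities suffice, because
  the product must cover \<open>a * a\<close> elements.\<close>

lemma near_factorization_dihedral_of_int:
  assumes "n > 0" and a: "a * a = 2 * n - 1"
    and "finite A" "card A \<le> a" and "finite B" "card B \<le> a"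
    and sym: "\<And>y. y \<in> B \<Longrightarrow> - y \<in> B"
    and sum: "(\<lambda>(x, y). x + y) ` (A \<times> B) = {1 - int n..int n - 1}"
  shows "near_factorization (dihedral_group n) a a
           (dihedral_of_int n ` A) (dihedral_of_int n ` (+) (int n) ` B)"
proof -
  let ?G = "dihedral_group n" and ?A = "dihedral_of_int n ` A"
  let ?B = "dihedral_of_int n ` (+) (int n) ` B"
  \<comment> \<open>The partner of \<open>n + b\<close> is \<open>n - b\<close>: their sum is
    \<open>2n\<close>, not \<open>0\<close>.\<close>
  have *: "\<exists>y'\<in>(+) (int n) ` B. 2 * int n dvd y + y'" if y: "y \<in> (+) (int n) ` B" for y
  proof -
    obtain b where b: "b \<in> B" "y = int n + b" using y by auto
    then have "y + (int n + - b) = 2 * int n" by simp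
    then show ?thesis
      using sym [OF b(1)] by (metis dvd_refl imageI)
  qed
  have "(\<lambda>(x, y). x + y) ` (A \<times> (+) (int n) ` B) = (+) (int n) ` (\<lambda>(x, y). x + y) ` (A \<times> B)"
    by (force simp: image_iff)
  also have "\<dots> = {1..<2 * int n}"
    unfolding sum by (auto simp: image_add_atLeastAtMost)
  finally have "?A <#>\<^bsub>?G\<^esub> ?B = dihedral_of_int n ` {1..<2 * int n}"
    using set_mult_dihedral_of_int [OF *] by simp
  also have "\<dots> = carrier ?G - {\<one>\<^bsub>?G\<^esub>}"
  proof -
    have "{0..<2 * int n} = insert 0 {1..<2 * int n}"
      using \<open>n > 0\<close> by auto
    then have "carrier ?G = insert (\<one>\<^bsub>?G\<^esub>) (dihedral_of_int n ` {1..<2 * int n})"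
      by (simp add: carrier_dihedral_group_image [OF \<open>n > 0\<close>] one_dihedral_group)
    moreover have "\<one>\<^bsub>?G\<^esub> \<notin> dihedral_of_int n ` {1..<2 * int n}"
      using zdvd_not_zless by (fastforce simp: one_dihedral_group dihedral_of_int_eq_iff)
    ultimately show ?thesis by auto
  qed
  finally have prod: "?A <#>\<^bsub>?G\<^esub> ?B = carrier ?G - {\<one>\<^bsub>?G\<^esub>}" .
  have le: "card ?A \<le> a" "card ?B \<le> a"
    using assms by (meson card_image_le finite_imageI le_trans)+
  \<comment> \<open>Counting the product gives \<open>a * a \<le> card ?A * card ?B\<close>; as
    neither factor exceeds \<open>a\<close>, both must equal \<open>a\<close>. So no collisions
    occur under \<open>dihedral_of_int\<close>.\<close>
  have "a * a = card (carrier ?G - {\<one>\<^bsub>?G\<^esub>})"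
    using a order_dihedral_group [of n] \<open>n > 0\<close>
    by (simp add: order_def finite_dihedral_group one_dihedral_group dihedral_of_int_closed)
  also have "\<dots> \<le> card ?A * card ?B"
    unfolding prod [symmetric] using assms by (intro card_set_mult_le) auto
  finally have ge: "a * a \<le> card ?A * card ?B" .
  have card: "card ?A = a" "card ?B = a"
  proof -
    have "a > 0" using a \<open>n > 0\<close> by (cases a) auto
    have "a * a \<le> card ?A * a" "a * a \<le> a * card ?B"
      using ge le by (meson le_trans mult_le_mono order_refl)+
    then show "card ?A = a" "card ?B = a"
      using le \<open>a > 0\<close> by auto
  qed
  show ?thesis
    unfolding near_factorization_def card prod order_dihedral_group
    using a group_dihedral_group [OF \<open>n > 0\<close>] finite_dihedral_group
      dihedral_of_int_closed [OF \<open>n > 0\<close>] by auto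
qed

section \<open>An invariant of equivalence\<close>

text \<open>In a quotient \<open>(f x h) (f y h)^-1\<close> the translation by \<open>h\<close>
  cancels, so the new quotient set is the image of the old one under the injective map
  \<open>f\<close>.\<close>

lemma card_mult_set_inv_equivalent:
  assumes "group G" and "A \<subseteq> carrier G"
    and "equivalent_near_factorizations G (A, B) (A', B')"
  shows "card (A' <#>\<^bsub>G\<^esub> set_inv\<^bsub>G\<^esub> A') = card (A <#>\<^bsub>G\<^esub> set_inv\<^bsub>G\<^esub> A)"
proof -
  interpret group G by fact
  obtain f h where f: "f \<in> auto G" and h: "h \<in> carrier G" and A': "A' = f ` A #>\<^bsub>G\<^esub> h"
    using assms(3) by (auto simp: equivalent_near_factorizations_def)
  have hom: "f \<in> hom G G" and bij: "bij_betw f (carrier G) (carrier G)"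
    using f by (auto simp: auto_def Bij_def)
  have eq: "(f x \<otimes>\<^bsub>G\<^esub> h) \<otimes>\<^bsub>G\<^esub> inv\<^bsub>G\<^esub> (f y \<otimes>\<^bsub>G\<^esub> h) = f (x \<otimes>\<^bsub>G\<^esub> inv\<^bsub>G\<^esub> y)"
    if "x \<in> A" "y \<in> A" for x y
  proof -
    have xy: "x \<in> carrier G" "y \<in> carrier G" using that assms(2) by auto
    interpret group_hom G G f using hom by unfold_locales
    have "h \<otimes>\<^bsub>G\<^esub> (inv\<^bsub>G\<^esub> h \<otimes>\<^bsub>G\<^esub> inv\<^bsub>G\<^esub> f y) = inv\<^bsub>G\<^esub> f y"
      using xy h by (simp flip: m_assoc)
    then show ?thesis using xy h by (simp add: inv_mult_group m_assoc)
  qed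
  have "A' <#>\<^bsub>G\<^esub> set_inv\<^bsub>G\<^esub> A'
      = (\<Union>x\<in>A. \<Union>y\<in>A. {(f x \<otimes>\<^bsub>G\<^esub> h) \<otimes>\<^bsub>G\<^esub> inv\<^bsub>G\<^esub> (f y \<otimes>\<^bsub>G\<^esub> h)})"
    unfolding A' by (auto simp: set_mult_def SET_INV_def r_coset_def)
  also have "\<dots> = f ` (A <#>\<^bsub>G\<^esub> set_inv\<^bsub>G\<^esub> A)"
    by (auto simp: set_mult_def SET_INV_def eq)
  finally show ?thesis
    using bij assms(2)
    by (auto intro!: card_image elim!: inj_on_subset simp: bij_betw_def set_mult_def SET_INV_def
        subset_iff)
qed

section \<open>Balanced digits and the two factors\<close>

text \<open>Division with remainder by \<open>2 * p + 1\<close>, after a shift by \<open>p\<close>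
  that centres the remainder at \<open>0\<close>.\<close>

lemma balanced_digit_expansion:
  fixes p m :: int
  assumes "p \<ge> 0"
  shows "(\<lambda>(x, y). x + (2 * p + 1) * y) ` ({-p..p} \<times> {-m..m})
           = {-(p + (2 * p + 1) * m)..p + (2 * p + 1) * m}" (is "?L = ?R")
proof (intro equalityI subsetI)
  fix z assume "z \<in> ?L"
  then obtain x y where *: "z = x + (2 * p + 1) * y" "\<bar>x\<bar> \<le> p" "\<bar>y\<bar> \<le> m" by auto
  then have "(2 * p + 1) * y \<le> (2 * p + 1) * m" "(2 * p + 1) * - m \<le> (2 * p + 1) * y"
    using assms by (intro mult_left_mono; simp)+
  with * show "z \<in> ?R" unfolding atLeastAtMost_iff abs_le_iff by linarith
next
  fix z assume z: "z \<in> ?R"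
  define y where "y = (z + p) div (2 * p + 1)"
  define x where "x = (z + p) mod (2 * p + 1) - p"
  have zxy: "z = x + (2 * p + 1) * y"
    using mult_div_mod_eq [of "2 * p + 1" "z + p"] unfolding x_def y_def by linarith
  have x: "x \<in> {-p..p}"
    using pos_mod_bound [of "2 * p + 1" "z + p"] pos_mod_sign [of "2 * p + 1" "z + p"] assms
    unfolding x_def by auto
  \<comment> \<open>The bounds on \<open>z\<close> and \<open>x\<close> leave an error of at most
    \<open>2 * p\<close>, less than one unit of \<open>2 * p + 1\<close>; the strict inequality then
    pins \<open>y\<close> to the range.\<close>
  have "(2 * p + 1) * y < (2 * p + 1) * (m + 1)" "(2 * p + 1) * (- m - 1) < (2 * p + 1) * y"
    using zxy x z by (auto simp: algebra_simps)
  then have "y < m + 1" "- m - 1 < y"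
    using assms by (simp_all add: mult_less_cancel_left)
  then show "z \<in> ?L" using x zxy by auto
qed

text \<open>Here \<open>j = 2p + 1\<close> and \<open>k = 2q + 1\<close>.\<close>

definition left_factor :: "int \<Rightarrow> int \<Rightarrow> int set" where
  "left_factor p q = (\<lambda>(x, y). x + (2 * p + 1) * (2 * q + 1) * y) ` ({-p..p} \<times> {-q..q})"

definition right_factor :: "int \<Rightarrow> int \<Rightarrow> int set" where
  "right_factor p q = (\<lambda>(x, y). (2 * p + 1) * x + (2 * p + 1) * (2 * q + 1)\<^sup>2 * y) ` ({-q..q} \<times> {-p..p})"

lemma image_Times_eq_UN: "(\<lambda>(x, y). f x y) ` (S \<times> T) = (\<Union>x\<in>S. f x ` T)"
  by auto

text \<open>The left factor holds the digits of weights \<open>1\<close> and \<open>jk\<close>, the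
  right one those of weights \<open>j\<close> and \<open>jk^2\<close>. Regrouped in Horner form,
  their sum is three nested balanced expansions.\<close>

lemma left_factor_add_right_factor:
  assumes "p \<ge> 0" "q \<ge> 0" and n: "2 * n - 1 = ((2 * p + 1) * (2 * q + 1))\<^sup>2"
  shows "(\<lambda>(x, y). x + y) ` (left_factor p q \<times> right_factor p q) = {1 - n..n - 1}"
proof -
  let ?j = "2 * p + 1" and ?k = "2 * q + 1"
  \<comment> \<open>\<open>m1\<close> and \<open>m2\<close> are the upper ends of the intervals
    filled by the innermost two and three digits; all four digits reach
    \<open>n - 1\<close>.\<close>
  define m1 where "m1 = q + ?k * p"
  define m2 where "m2 = q + ?k * m1"
  have "2 * (p + ?j * m2) + 1 = (?j * ?k)\<^sup>2"
    by (simp add: m1_def m2_def power2_eq_square algebra_simps)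
  then have m3: "p + ?j * m2 = n - 1" using n by simp
  have "(\<lambda>(x, y). x + y) ` (left_factor p q \<times> right_factor p q)
     = (\<Union>x\<in>{-p..p}. \<Union>x'\<in>{-q..q}. \<Union>y\<in>{-q..q}. \<Union>y'\<in>{-p..p}. {x + ?j * (x' + ?k * (y + ?k * y'))})"
    (is "_ = ?S")
  proof (intro equalityI subsetI)
    have expand: "x + ?j * (x' + ?k * (y + ?k * y')) = (x + ?j * ?k * y) + (?j * x' + ?j * ?k\<^sup>2 * y')"
      for x x' y y' by (simp add: power2_eq_square algebra_simps)
    { fix z assume "z \<in> (\<lambda>(x, y). x + y) ` (left_factor p q \<times> right_factor p q)"
      then obtain x y x' y' where "z = (x + ?j * ?k * y) + (?j * x' + ?j * ?k\<^sup>2 * y')"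
        "x \<in> {-p..p}" "y \<in> {-q..q}" "x' \<in> {-q..q}" "y' \<in> {-p..p}"
        unfolding left_factor_def right_factor_def by auto
      then show "z \<in> ?S" unfolding expand by blast }
    { fix z assume "z \<in> ?S"
      then obtain x y x' y' where z: "z = (x + ?j * ?k * y) + (?j * x' + ?j * ?k\<^sup>2 * y')"
        and "x \<in> {-p..p}" "y \<in> {-q..q}" "x' \<in> {-q..q}" "y' \<in> {-p..p}"
        unfolding expand by blast
      then have "x + ?j * ?k * y \<in> left_factor p q" "?j * x' + ?j * ?k\<^sup>2 * y' \<in> right_factor p q"
        unfolding left_factor_def right_factor_def by force+
      then show "z \<in> (\<lambda>(x, y). x + y) ` (left_factor p q \<times> right_factor p q)"
        unfolding z by (intro image_eqI [of _ _ "(_, _)"]) auto }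
  qed
  also have "\<dots> = (\<lambda>(x, y). x + ?j * y) ` ({-p..p} \<times>
       (\<lambda>(x, y). x + ?k * y) ` ({-q..q} \<times> (\<lambda>(x, y). x + ?k * y) ` ({-q..q} \<times> {-p..p})))"
    by (simp add: image_Times_eq_UN image_UN image_image UNION_singleton_eq_range)
  also have "\<dots> = {1 - n..n - 1}"
    using assms by (simp add: balanced_digit_expansion m1_def [symmetric] m2_def [symmetric] m3)
  finally show ?thesis .
qed

text \<open>Addition acts digit by digit, and a symmetric interval added to itself is the interval
  of twice the radius.\<close>

lemma left_factor_add_left_factor:
  assumes "p \<ge> 0" "q \<ge> 0"
  shows "(\<lambda>(x, y). x + y) ` (left_factor p q \<times> left_factor p q)
    = (\<lambda>(x, y). x + (2 * p + 1) * (2 * q + 1) * y) ` ({-2 * p..2 * p} \<times> {-2 * q..2 * q})"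
    (is "?L = ?f ` ?R")
proof (intro equalityI subsetI)
  fix z assume "z \<in> ?L"
  then obtain x y x' y' where *: "z = ?f (x, y) + ?f (x', y')"
    "x \<in> {-p..p}" "x' \<in> {-p..p}" "y \<in> {-q..q}" "y' \<in> {-q..q}"
    unfolding left_factor_def by auto
  have "z = ?f (x + x', y + y')" unfolding *(1) by (simp add: algebra_simps)
  moreover have "(x + x', y + y') \<in> ?R" using * by auto
  ultimately show "z \<in> ?f ` ?R" by (rule image_eqI)
next
  fix z assume "z \<in> ?f ` ?R"
  then obtain x y where *: "z = ?f (x, y)" "x \<in> {-2 * p..2 * p}" "y \<in> {-2 * q..2 * q}" by auto
  \<comment> \<open>Rounding \<open>w / 2\<close> down and up yields the two summands, for odd
    \<open>w\<close> as well.\<close>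
  have half: "\<exists>u\<in>{-m..m}. \<exists>v\<in>{-m..m}. w = u + v" if "w \<in> {-2 * m..2 * m}" for w m :: int
    using that by (intro bexI [of _ "w div 2"] bexI [of _ "w - w div 2"]) auto
  obtain x1 x2 y1 y2 where halves: "x = x1 + x2" "x1 \<in> {-p..p}" "x2 \<in> {-p..p}"
    "y = y1 + y2" "y1 \<in> {-q..q}" "y2 \<in> {-q..q}"
    using half [OF *(2)] half [OF *(3)] by blast
  have "z = ?f (x1, y1) + ?f (x2, y2)"
    unfolding *(1) halves(1,4) by (simp add: algebra_simps)
  moreover have "?f (x1, y1) \<in> left_factor p q" "?f (x2, y2) \<in> left_factor p q"
    unfolding left_factor_def using halves by (intro imageI; simp)+
  ultimately show "z \<in> ?L" unfolding image_Times_eq_UN by blast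
qed

lemma uminus_left_factor:
  assumes "z \<in> left_factor p q"
  shows "- z \<in> left_factor p q"
proof -
  obtain x y where *: "z = x + (2 * p + 1) * (2 * q + 1) * y" "x \<in> {-p..p}" "y \<in> {-q..q}"
    using assms unfolding left_factor_def by auto
  then have "- z = - x + (2 * p + 1) * (2 * q + 1) * - y" by simp
  with * show ?thesis
    unfolding left_factor_def by (intro image_eqI [of _ _ "(- x, - y)"]) auto
qed

lemma uminus_right_factor:
  assumes "z \<in> right_factor p q"
  shows "- z \<in> right_factor p q"
proof -
  obtain x y where *: "z = (2 * p + 1) * x + (2 * p + 1) * (2 * q + 1)\<^sup>2 * y"
    "x \<in> {-q..q}" "y \<in> {-p..p}"
    using assms unfolding right_factor_def by auto
  then have "- z = (2 * p + 1) * - x + (2 * p + 1) * (2 * q + 1)\<^sup>2 * - y" by simp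
  with * show ?thesis
    unfolding right_factor_def by (intro image_eqI [of _ _ "(- x, - y)"]) auto
qed

lemma finite_factors: "finite (left_factor p q)" "finite (right_factor p q)"
  by (simp_all add: left_factor_def right_factor_def)

text \<open>Counting digit pairs is enough here: equality follows later from
  \<open>near_factorization_dihedral_of_int\<close>, so injectivity of the digit maps is not
  shown.\<close>

lemma card_factors_le:
  assumes "p \<ge> 0" "q \<ge> 0"
  shows "card (left_factor p q) \<le> nat ((2 * p + 1) * (2 * q + 1))"
    and "card (right_factor p q) \<le> nat ((2 * p + 1) * (2 * q + 1))"
proof -
  have "card ({-p..p} \<times> {-q..q}) = nat ((2 * p + 1) * (2 * q + 1))"
    "card ({-q..q} \<times> {-p..p}) = nat ((2 * p + 1) * (2 * q + 1))"
    using assms by (simp_all add: nat_mult_distrib [symmetric] algebra_simps)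
  then show "card (left_factor p q) \<le> nat ((2 * p + 1) * (2 * q + 1))"
    "card (right_factor p q) \<le> nat ((2 * p + 1) * (2 * q + 1))"
    unfolding left_factor_def right_factor_def
    by (metis card_image_le finite_SigmaI finite_atLeastAtMost_int)+
qed

lemma near_factorization_left_right_factor:
  assumes "p \<ge> 0" "q \<ge> 0" and a: "int a = (2 * p + 1) * (2 * q + 1)" and n: "2 * n - 1 = a\<^sup>2"
  shows "near_factorization (dihedral_group n) a a
           (dihedral_of_int n ` left_factor p q) (dihedral_of_int n ` (+) (int n) ` right_factor p q)"
proof (rule near_factorization_dihedral_of_int)
  have "a > 0"
    using assms by (simp flip: of_nat_0_less_iff [where 'a = int])
  then show "n > 0" using n by (cases n) auto
  then have "2 * int n - 1 = (int a)\<^sup>2"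
    using n by (simp flip: of_nat_power n add: of_nat_diff)
  then show "(\<lambda>(x, y). x + y) ` (left_factor p q \<times> right_factor p q) = {1 - int n..int n - 1}"
    using left_factor_add_right_factor [of p q "int n"] assms by simp
  show "card (left_factor p q) \<le> a" "card (right_factor p q) \<le> a"
    using card_factors_le [OF assms(1,2)] by (simp_all flip: a)
  show "a * a = 2 * n - 1" using n by (simp add: power2_eq_square)
qed (simp_all only: finite_factors uminus_right_factor)

section \<open>The size of the invariant for the constructed factors\<close>

text \<open>The left factor is symmetric, so its image is closed under inversion and the quotient
  set is the image of a sumset.\<close>

lemma left_factor_mult_set_inv:
  assumes "p \<ge> 0" "q \<ge> 0" and "n > 0"
  shows "dihedral_of_int n ` left_factor p q <#>\<^bsub>dihedral_group n\<^esub>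
           set_inv\<^bsub>dihedral_group n\<^esub> (dihedral_of_int n ` left_factor p q)
       = (\<lambda>(x, y). dihedral_of_int n (x + (2 * p + 1) * (2 * q + 1) * y)) `
           ({-2 * p..2 * p} \<times> {-2 * q..2 * q})"
proof -
  have "\<exists>y'\<in>left_factor p q. 2 * int n dvd y + y'" if "y \<in> left_factor p q" for y
    using uminus_left_factor [OF that] by (intro bexI [of _ "- y"]) auto
  then have "dihedral_of_int n ` left_factor p q <#>\<^bsub>dihedral_group n\<^esub> dihedral_of_int n ` left_factor p q
      = dihedral_of_int n ` (\<lambda>(x, y). x + y) ` (left_factor p q \<times> left_factor p q)"
    by (rule set_mult_dihedral_of_int)
  moreover have "set_inv\<^bsub>dihedral_group n\<^esub> (dihedral_of_int n ` left_factor p q)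
      = dihedral_of_int n ` left_factor p q"
    using \<open>n > 0\<close> uminus_left_factor by (rule set_inv_dihedral_of_int)
  ultimately show ?thesis
    unfolding left_factor_add_left_factor [OF assms(1,2)]
    by (simp only: image_image case_prod_unfold)
qed

lemma dvd_abs_less_imp_zero: "d dvd x \<Longrightarrow> \<bar>x\<bar> < d \<Longrightarrow> x = 0" for d x :: int
  using dvd_imp_le_int [of x d] by linarith

text \<open>Distinct doubled digit pairs give distinct elements: two values differ by less than
  \<open>2n\<close>, so congruence means equality, and the low digits differ by at most
  \<open>4 * p\<close>, less than the weight \<open>jk\<close> of the high digit.\<close>

lemma card_left_factor_mult_set_inv:
  assumes "p \<ge> 1" "q \<ge> 1" and n: "2 * int n - 1 = ((2 * p + 1) * (2 * q + 1))\<^sup>2"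
  shows "card (dihedral_of_int n ` left_factor p q <#>\<^bsub>dihedral_group n\<^esub>
           set_inv\<^bsub>dihedral_group n\<^esub> (dihedral_of_int n ` left_factor p q))
       = nat ((4 * p + 1) * (4 * q + 1))"
proof -
  define a where "a = (2 * p + 1) * (2 * q + 1)"
  have a: "4 * p < a" "0 < a"
  proof -
    have "4 * p < (2 * p + 1) * 3" using assms(1) by simp
    also have "\<dots> \<le> a"
      unfolding a_def using assms(1,2) by (intro mult_left_mono) auto
    finally show "4 * p < a" .
    with assms(1) show "0 < a" by simp
  qed
  \<comment> \<open>From \<open>a \<ge> 3 * (2 * q + 1)\<close> comes
    \<open>a * a \<ge> 6 * q * a + 3 * a\<close>, which exceeds \<open>4 * q * a + 4 * p\<close>
    because \<open>4 * p < a\<close>.\<close>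
  have wide: "4 * p + 4 * q * a < 2 * int n"
  proof -
    have "a * q \<ge> 0" using a assms by simp
    moreover have "a * (3 * (2 * q + 1)) \<le> a * a"
    proof (rule mult_left_mono)
      show "3 * (2 * q + 1) \<le> a"
        unfolding a_def using assms by (intro mult_right_mono) auto
    qed (use a in simp)
    moreover have "2 * int n = a * a + 1"
      using n by (simp add: a_def power2_eq_square)
    ultimately show ?thesis using a by (simp add: algebra_simps)
  qed
  have inj: "x = x' \<and> y = y'"
    if bounds: "x \<in> {-2 * p..2 * p}" "y \<in> {-2 * q..2 * q}"
      "x' \<in> {-2 * p..2 * p}" "y' \<in> {-2 * q..2 * q}"
      and "dihedral_of_int n (x + a * y) = dihedral_of_int n (x' + a * y')" for x y x' y'
  proof -
    have dvd: "2 * int n dvd (x - x') + a * (y - y')"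
      using that(5) by (simp add: dihedral_of_int_eq_iff algebra_simps)
    have x: "\<bar>x - x'\<bar> \<le> 4 * p" and y: "\<bar>y - y'\<bar> \<le> 4 * q"
      using bounds by auto
    have "\<bar>a * (y - y')\<bar> \<le> a * (4 * q)"
      using y a by (simp add: abs_mult)
    then have "\<bar>(x - x') + a * (y - y')\<bar> < 2 * int n"
      using x wide by (simp add: algebra_simps)
    then have eq: "(x - x') + a * (y - y') = 0"
      using dvd dvd_abs_less_imp_zero by blast
    then have "x - x' = a * (y' - y)"
      by (simp add: algebra_simps)
    then have "x - x' = 0"
      using x a by (intro dvd_abs_less_imp_zero [of a]) auto
    then show "x = x' \<and> y = y'" using eq a by auto
  qed
  have "inj_on (\<lambda>(x, y). dihedral_of_int n (x + a * y)) ({-2 * p..2 * p} \<times> {-2 * q..2 * q})"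
  proof (rule inj_onI)
    fix u v assume "u \<in> {-2 * p..2 * p} \<times> {-2 * q..2 * q}" "v \<in> {-2 * p..2 * p} \<times> {-2 * q..2 * q}"
      "(\<lambda>(x, y). dihedral_of_int n (x + a * y)) u = (\<lambda>(x, y). dihedral_of_int n (x + a * y)) v"
    then show "u = v"
      using inj [of "fst u" "snd u" "fst v" "snd v"]
      by (simp only: mem_Times_iff case_prod_unfold prod_eq_iff)
  qed
  then have "card ((\<lambda>(x, y). dihedral_of_int n (x + a * y)) ` ({-2 * p..2 * p} \<times> {-2 * q..2 * q}))
      = card ({-2 * p..2 * p} \<times> {-2 * q..2 * q})"
    by (rule card_image)
  also have "\<dots> = nat ((4 * p + 1) * (4 * q + 1))"
    using assms(1,2) by (simp add: card_cartesian_product nat_mult_distrib add.commute)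
  finally have card: "card ((\<lambda>(x, y). dihedral_of_int n (x + a * y)) `
      ({-2 * p..2 * p} \<times> {-2 * q..2 * q})) = nat ((4 * p + 1) * (4 * q + 1))" .
  have "0 \<le> 4 * p + 4 * q * a" using a assms(1,2) by simp
  then have "n > 0" using wide by linarith
  have "0 \<le> p" "0 \<le> q" using assms(1,2) by simp_all
  then show ?thesis
    using card \<open>n > 0\<close> by (simp only: left_factor_mult_set_inv a_def)
qed

text \<open>With \<open>q = 0\<close> the high digit is always \<open>0\<close>, leaving
  \<open>4 * p + 1\<close> digit pairs.\<close>

lemma card_left_factor_0_mult_set_inv_le:
  assumes "p \<ge> 0" and "n > 0"
  shows "card (dihedral_of_int n ` left_factor p 0 <#>\<^bsub>dihedral_group n\<^esub>
           set_inv\<^bsub>dihedral_group n\<^esub> (dihedral_of_int n ` left_factor p 0)) \<le> nat (4 * p + 1)"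
  unfolding left_factor_mult_set_inv [OF assms(1) order_refl assms(2)]
  by (rule order_trans [OF card_image_le]) (use assms in auto)

theorem theorem4p1:
  fixes a j k n :: nat
  assumes "odd a" and "a = j * k" and "j > 1" and "k > 1"
    and "n = (a ^ 2 + 1) div 2"
  shows "\<exists>A B A' B'.
           near_factorization (dihedral_group n) a a A B \<and>
           near_factorization (dihedral_group n) a a A' B' \<and>
           \<not> equivalent_near_factorizations (dihedral_group n) (A, B) (A', B')"
proof (intro exI conjI)
  let ?G = "dihedral_group n"
  \<comment> \<open>\<open>r\<close> belongs to the trivial splitting of \<open>a\<close> as
    \<open>a * 1\<close>, used with second parameter \<open>0\<close>.\<close>
  define p q r where "p = int j div 2" and "q = int k div 2" and "r = int a div 2"
  have "odd j" "odd k" using assms by auto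
  then have j: "int j = 2 * p + 1" and k: "int k = 2 * q + 1" and r: "int a = 2 * r + 1"
    using assms(1) unfolding p_def q_def r_def by (simp_all add: odd_two_times_div_two_succ)
  have pq: "p \<ge> 1" "q \<ge> 1" "r \<ge> 0"
    using assms(3,4) j k r by linarith+
  have pqr: "int a = (2 * p + 1) * (2 * q + 1)"
    using assms(2) j k by simp
  have n: "2 * n - 1 = a\<^sup>2" "n > 0" and n': "2 * int n - 1 = (int a)\<^sup>2"
  proof -
    have "2 * n = a\<^sup>2 + 1" using assms(1,5) by simp
    then show "2 * n - 1 = a\<^sup>2" "n > 0" "2 * int n - 1 = (int a)\<^sup>2"
      by (auto simp flip: of_nat_power)
  qed
  show nf: "near_factorization ?G a a (dihedral_of_int n ` left_factor r 0)
      (dihedral_of_int n ` (+) (int n) ` right_factor r 0)"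
    using r pq n by (intro near_factorization_left_right_factor) auto
  show "near_factorization ?G a a (dihedral_of_int n ` left_factor p q)
      (dihedral_of_int n ` (+) (int n) ` right_factor p q)"
    using pqr pq n by (intro near_factorization_left_right_factor) auto
  show "\<not> equivalent_near_factorizations ?G
      (dihedral_of_int n ` left_factor r 0, dihedral_of_int n ` (+) (int n) ` right_factor r 0)
      (dihedral_of_int n ` left_factor p q, dihedral_of_int n ` (+) (int n) ` right_factor p q)"
  proof
    assume "equivalent_near_factorizations ?G
      (dihedral_of_int n ` left_factor r 0, dihedral_of_int n ` (+) (int n) ` right_factor r 0)
      (dihedral_of_int n ` left_factor p q, dihedral_of_int n ` (+) (int n) ` right_factor p q)"
    from card_mult_set_inv_equivalent [OF _ _ this]
    have "nat ((4 * p + 1) * (4 * q + 1)) \<le> nat (4 * r + 1)"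
      using nf card_left_factor_mult_set_inv [of p q n] card_left_factor_0_mult_set_inv_le [of r n]
        pq n n' pqr
      by (simp add: near_factorization_def)
    then have "(4 * p + 1) * (4 * q + 1) \<le> 4 * r + 1"
      using pq by (subst (asm) nat_le_eq_zle) auto
    also have "\<dots> = 2 * ((2 * p + 1) * (2 * q + 1)) - 1"
      using r pqr by simp
    finally have "(4 * p + 1) * (4 * q + 1) \<le> 2 * ((2 * p + 1) * (2 * q + 1)) - 1" .
    \<comment> \<open>The left side exceeds the right by exactly \<open>8 * (p * q)\<close>.\<close>
    then have "8 * (p * q) \<le> 0" by (simp add: algebra_simps)
    moreover have "0 < p * q" using pq by simp
    ultimately show False by linarith
  qed
qed

end
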